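(* Let $(X,\rho)$ be a metric space with $|X|\geq 3$, let $\lambda\in[0,1)$, and let $T:X\to CB(X)$ be a multivalued $\lambda$-contracting perimeters of triangles mapping on $X$, i.e. $$H(Tx,Ty)+H(Ty,Tz)+H(Tx,Tz)\leq \lambda\left(\rho(x,y)+\rho(y,z)+\rho(x,z)\right)$$ for all three pairwise distinct points $x,y,z\in X$. If there is no isolated point in $X$, then $T$ is a multivalued $\lambda$-contraction mapping, i.e. $H(Tx,Ty)\leq\lambda\rho(x,y)$ for all $x,y\in X$.
   Context: For a metric space $(X,\rho)$, $CB(X)$ denotes the class of all nonempty closed and bounded subsets of $X$, and $H$ is the Pompeiu–Hausdorff metric on $CB(X)$ induced by $\rho$: $H(A,B)=\max\{\sup_{a\in A}\rho(a,B),\ \sup_{b\in B}\rho(b,A)\}$, where $\rho(a,B)=\inf_{b\in B}\rho(a,b)$. *)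

theory Defs
  imports "HOL-Analysis.Analysis"
begin

definition CB :: "'a::metric_space set set" where
  "CB = {A. A \<noteq> {} \<and> closed A \<and> bounded A}"

(* The suprema and infima are over the reals: they have their usual meaning only
   for nonempty bounded arguments, in particular for all A, B in CB. *)
definition hausdorff_dist :: "'a::metric_space set \<Rightarrow> 'a set \<Rightarrow> real" where
  "hausdorff_dist A B = max (SUP a\<in>A. infdist a B) (SUP b\<in>B. infdist b A)"

definition contracting_perimeters ::
  "real \<Rightarrow> ('a::metric_space \<Rightarrow> 'a set) \<Rightarrow> bool" where
  "contracting_perimeters c T \<longleftrightarrow>
     (\<forall>x y z. x \<noteq> y \<longrightarrow> y \<noteq> z \<longrightarrow> x \<noteq> z \<longrightarrow>
        hausdorff_dist (T x) (T y) + hausdorff_dist (T y) (T z) + hausdorff_dist (T x) (T z)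
          \<le> c * (dist x y + dist y z + dist x z))"

definition multivalued_contraction ::
  "real \<Rightarrow> ('a::metric_space \<Rightarrow> 'a set) \<Rightarrow> bool" where
  "multivalued_contraction c T \<longleftrightarrow>
     (\<forall>x y. hausdorff_dist (T x) (T y) \<le> c * dist x y)"

end

theory Submission
  imports Defs
begin

text \<open>By the triangle inequality for the Pompeiu--Hausdorff metric, the left-hand side of the
  perimeter condition is at least \<open>2 H(Tx,Ty)\<close>, and its right-hand side is at most
  \<open>2 c (\<rho>(x,y) + \<rho>(x,z))\<close>. Since \<open>x\<close> is not isolated, \<open>z\<close> can be chosen arbitrarily close to \<open>x\<close>;
  continuity of \<open>T\<close> is not needed.\<close>

text \<open>Any fixed \<open>b\<close> in \<open>B\<close> gives
  \<open>infdist a B \<le> dist a b\<close>, which is bounded over the bounded set \<open>A\<close>.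
  This makes the real \<open>SUP\<close> in \<open>hausdorff_dist\<close> an actual upper
  bound.\<close>

lemma bdd_above_infdist_image:
  assumes "bounded A" "B \<noteq> {}"
  shows "bdd_above ((\<lambda>a. infdist a B) ` A)"
proof -
  from \<open>B \<noteq> {}\<close> obtain b where b: "b \<in> B" by blast
  from \<open>bounded A\<close> obtain e where "\<forall>a\<in>A. dist b a \<le> e"
    using bounded_any_center by blast
  then have "infdist a B \<le> e" if "a \<in> A" for a
    using infdist_le[OF b, of a] that by (force simp: dist_commute)
  then show ?thesis by (rule bdd_aboveI2)
qed

lemma hausdorff_dist_commute: "hausdorff_dist A B = hausdorff_dist B A"
  by (simp add: hausdorff_dist_def max.commute)

lemma hausdorff_dist_self:
  assumes "A \<noteq> {}"
  shows "hausdorff_dist A A = 0"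
  using assms by (simp add: hausdorff_dist_def)

lemma infdist_le_hausdorff_dist:
  assumes "bounded A" "B \<noteq> {}" "a \<in> A"
  shows "infdist a B \<le> hausdorff_dist A B"
  using cSUP_upper[OF \<open>a \<in> A\<close> bdd_above_infdist_image[OF assms(1,2)]]
  by (simp add: hausdorff_dist_def max.coboundedI1)

text \<open>Each \<open>b\<close> in \<open>B\<close> gives a bound through \<open>dist a b\<close>;
  passing to the infimum over \<open>b\<close> avoids choosing a nearest point of \<open>B\<close>,
  which may not exist.\<close>

lemma infdist_triangle_hausdorff_dist:
  assumes "bounded B" "B \<noteq> {}" "C \<noteq> {}"
  shows "infdist a C \<le> infdist a B + hausdorff_dist B C"
proof -
  have "infdist a C - hausdorff_dist B C \<le> dist a b" if "b \<in> B" for b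
    using infdist_triangle[of a C b] infdist_le_hausdorff_dist[OF assms(1,3) that] by linarith
  then have "infdist a C - hausdorff_dist B C \<le> (INF b\<in>B. dist a b)"
    by (intro cINF_greatest \<open>B \<noteq> {}\<close>)
  then show ?thesis by (simp add: infdist_notempty[OF \<open>B \<noteq> {}\<close>])
qed

lemma hausdorff_dist_triangle:
  assumes "A \<in> CB" "B \<in> CB" "C \<in> CB"
  shows "hausdorff_dist A C \<le> hausdorff_dist A B + hausdorff_dist B C"
proof -
  have one_sided: "(SUP a\<in>A. infdist a C) \<le> hausdorff_dist A B + hausdorff_dist B C"
    if "A \<in> CB" "B \<in> CB" "C \<in> CB" for A B C :: "'a set"
  proof (rule cSUP_least)
    show "A \<noteq> {}" using that by (simp add: CB_def)
    show "infdist a C \<le> hausdorff_dist A B + hausdorff_dist B C" if "a \<in> A" for a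
      using infdist_triangle_hausdorff_dist[of B C a] infdist_le_hausdorff_dist[of A B a]
        that \<open>A \<in> CB\<close> \<open>B \<in> CB\<close> \<open>C \<in> CB\<close>
      by (simp add: CB_def)
  qed
  show ?thesis
    \<comment> \<open>The other supremum is the same bound with \<open>A\<close> and
      \<open>C\<close> exchanged, by symmetry of \<open>hausdorff_dist\<close>.\<close>
    using one_sided[OF assms] one_sided[OF assms(3,2,1)]
    by (simp add: hausdorff_dist_def[of A C] hausdorff_dist_commute add.commute)
qed

lemma not_isolated_in_UNIV_obtains_close:
  assumes "\<not> x isolated_in UNIV" "0 < e"
  obtains z where "z \<noteq> x" "dist x z < e"
proof -
  \<comment> \<open>Otherwise this open ball would witness that \<open>x\<close> is
    isolated.\<close>
  have "ball x e \<noteq> {x}"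
    using assms(1) open_ball[of x e] unfolding isolated_in_def by (metis Int_UNIV_right UNIV_I)
  moreover have "x \<in> ball x e" using \<open>0 < e\<close> by simp
  ultimately obtain z where "z \<in> ball x e" "z \<noteq> x" by blast
  then show thesis using that by simp
qed

theorem corollary1:
  fixes T :: "'a::metric_space \<Rightarrow> 'a set" and c :: real
  assumes "infinite (UNIV :: 'a set) \<or> card (UNIV :: 'a set) \<ge> 3"
    and "c \<in> {0..<1}"
    and "\<And>x. T x \<in> CB"
    and "contracting_perimeters c T"
    and "\<not> (\<exists>x::'a. x isolated_in UNIV)"
  shows "multivalued_contraction c T"
proof -
  have "hausdorff_dist (T x) (T y) \<le> c * dist x y" for x y
  \<comment> \<open>The perimeter condition covers only distinct points, so the diagonal is treated
    apart.\<close>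
  proof (cases "x = y")
    case True
    then show ?thesis using assms(3)[of y] by (simp add: CB_def hausdorff_dist_self)
  next
    case False
    show ?thesis
    proof (rule field_le_epsilon)
      fix e :: real assume "0 < e"
      \<comment> \<open>The bound \<open>dist x y\<close> forces \<open>z \<noteq> y\<close>; the
        bound \<open>e\<close> controls the error term \<open>c * dist x z\<close>.\<close>
      with False obtain z where z: "z \<noteq> x" "dist x z < min e (dist x y)"
        using not_isolated_in_UNIV_obtains_close[of x "min e (dist x y)"] assms(5) by auto
      then have "y \<noteq> z" by auto
      with False z have
        "hausdorff_dist (T x) (T y) + hausdorff_dist (T y) (T z) + hausdorff_dist (T x) (T z)
          \<le> c * (dist x y + dist y z + dist x z)"
        using assms(4) by (auto simp: contracting_perimeters_def)
      also have "\<dots> \<le> c * (2 * dist x y + 2 * dist x z)"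
        using assms(2) dist_triangle[of y z x]
        by (intro mult_left_mono) (auto simp: dist_commute)
      \<comment> \<open>The detour through \<open>T z\<close> bounds the left side below by twice
        \<open>hausdorff_dist (T x) (T y)\<close>; the factor 2 then cancels.\<close>
      finally have "hausdorff_dist (T x) (T y) \<le> c * dist x y + c * dist x z"
        using hausdorff_dist_triangle[OF assms(3) assms(3) assms(3), of x y z]
        by (simp add: hausdorff_dist_commute[of "T z" "T y"] algebra_simps)
      moreover have "c * dist x z \<le> e"
      proof -
        have "c * dist x z \<le> 1 * dist x z"
          using assms(2) by (intro mult_right_mono) auto
        with z show ?thesis by linarith
      qed
      ultimately show "hausdorff_dist (T x) (T y) \<le> c * dist x y + e" by linarith
    qed
  qed
  then show ?thesis by (simp add: multivalued_contraction_def)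
qed

end
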